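(* If $T$ is a tree with $n\ge2$ vertices, then $\tau_s(T)\le\lceil\log_2 n\rceil$.
   Context: For vertices $u,v,w$ of a connected graph, $w$ strongly resolves $u,v$ if there is a shortest $u$-$w$ path containing $v$ or a shortest $v$-$w$ path containing $u$. A strong resolving set is a set $W$ such that every pair of vertices is strongly resolved by some vertex of $W$; the strong dimension $\beta_s(H)$ is the minimum size of a strong resolving set of $H$. The threshold strong dimension $\tau_s(G)$ is the minimum of $\beta_s(H)$ over all graphs $H$ having $G$ as a spanning subgraph. *)

theory Defs
  imports Complex_Main "Graph_Theory.Graph_Theory"
begin

text \<open>
  A finite simple graph is a \<^locale>\<open>pair_graph\<close>: every edge is represented by its two opposite arcs.
\<close>

text \<open>
  The library's notions of forest and tree count the closed walk \<open>u, v, u\<close> as a cycle, so no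
  symmetric digraph with an edge satisfies them. In a simple graph represented by a symmetric
  digraph, the undirected cycles are exactly the directed cycles of length at least 3.
\<close>

definition undirected_tree :: "'a pair_pre_digraph \<Rightarrow> bool" where
  "undirected_tree G \<longleftrightarrow>
     pair_graph G \<and> Digraph_Component.connected (with_proj G) \<and>
     \<not> (\<exists>p. pre_digraph.cycle (with_proj G) p \<and> length p \<ge> 3)"

definition shortest_path :: "'a pair_pre_digraph \<Rightarrow> 'a \<Rightarrow> 'a vwalk \<Rightarrow> 'a \<Rightarrow> bool" where
  "shortest_path G u p v \<longleftrightarrow>
     vpath p (with_proj G) \<and> hd p = u \<and> last p = v \<and>
     (\<forall>q. vpath q (with_proj G) \<and> hd q = u \<and> last q = v \<longrightarrow> vwalk_length p \<le> vwalk_length q)"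

definition strongly_resolves :: "'a pair_pre_digraph \<Rightarrow> 'a \<Rightarrow> 'a \<Rightarrow> 'a \<Rightarrow> bool" where
  "strongly_resolves G w u v \<longleftrightarrow>
     (\<exists>p. shortest_path G u p w \<and> v \<in> set p) \<or> (\<exists>p. shortest_path G v p w \<and> u \<in> set p)"

definition strong_resolving_set :: "'a pair_pre_digraph \<Rightarrow> 'a set \<Rightarrow> bool" where
  "strong_resolving_set G W \<longleftrightarrow>
     W \<subseteq> pverts G \<and>
     (\<forall>u\<in>pverts G. \<forall>v\<in>pverts G. u \<noteq> v \<longrightarrow> (\<exists>w\<in>W. strongly_resolves G w u v))"

definition strong_dim :: "'a pair_pre_digraph \<Rightarrow> nat" where
  "strong_dim G = (LEAST k. \<exists>W. strong_resolving_set G W \<and> card W = k)"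

text \<open>
  Here \<open>spanning G H\<close> says that \<open>G\<close> is a spanning subgraph of \<open>H\<close>. If \<open>G\<close> is connected, then so is
  every such \<open>H\<close>, and both minima are attained (see the lemmas below).
\<close>

definition threshold_strong_dim :: "'a pair_pre_digraph \<Rightarrow> nat" where
  "threshold_strong_dim G =
     (LEAST k. \<exists>H. pair_graph H \<and> spanning (with_proj G) (with_proj H) \<and> strong_dim H = k)"

lemma strong_resolving_set_verts:
  assumes "pair_graph G" "Digraph_Component.connected (with_proj G)"
  shows "strong_resolving_set G (pverts G)"
  unfolding strong_resolving_set_def
proof (intro conjI ballI impI subset_refl)
  fix u v assume u: "u \<in> pverts G" and v: "v \<in> pverts G"
  interpret pair_graph G by fact
  have "strongly_connected (with_proj G)"
    using symmetric_connected_imp_strongly_connected[OF sym_arcs assms(2)] .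
  with u v have "u \<rightarrow>\<^sup>*\<^bsub>with_proj G\<^esub> v"
    by (simp add: strongly_connected_def)
  then obtain q where "vpath q (with_proj G) \<and> hd q = u \<and> last q = v"
    using reachable_vpath_conv by blast
  then have "\<exists>p. (vpath p (with_proj G) \<and> hd p = u \<and> last p = v) \<and>
     (\<forall>q. vpath q (with_proj G) \<and> hd q = u \<and> last q = v \<longrightarrow> vwalk_length p \<le> vwalk_length q)"
    by (rule ex_has_least_nat)
  then obtain p where p: "shortest_path G u p v"
    unfolding shortest_path_def by blast
  then have "v \<in> set p" by (auto simp: shortest_path_def vpath_def vwalk_def)
  with p v show "\<exists>w\<in>pverts G. strongly_resolves G w u v"
    unfolding strongly_resolves_def by blast
qed

lemma strong_dim_attained:
  assumes "pair_graph G" "Digraph_Component.connected (with_proj G)"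
  shows "\<exists>W. strong_resolving_set G W \<and> card W = strong_dim G"
  unfolding strong_dim_def
  by (rule LeastI_ex) (use strong_resolving_set_verts[OF assms] in blast)

lemma connected_if_spanning:
  assumes "Digraph_Component.connected (with_proj G)" "spanning (with_proj G) (with_proj H)"
  shows "Digraph_Component.connected (with_proj H)"
proof -
  interpret wf_digraph "with_proj H"
    using assms(2) by (simp add: spanning_def subgraph_def)
  from assms show ?thesis by (metis connected_spanning_imp_connected)
qed

lemma threshold_strong_dim_attained:
  assumes "pair_graph G"
  shows "\<exists>H. pair_graph H \<and> spanning (with_proj G) (with_proj H) \<and>
    strong_dim H = threshold_strong_dim G"
  unfolding threshold_strong_dim_def
proof (rule LeastI_ex)
  interpret pair_graph G by fact
  have "spanning (with_proj G) (with_proj G)"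
    by (simp add: spanning_def subgraph_def compatible_def wf_digraph)
  with assms show "\<exists>k H. pair_graph H \<and> spanning (with_proj G) (with_proj H) \<and> strong_dim H = k"
    by blast
qed

end

theory Submission
  imports Defs
begin

text \<open>
  Let \<open>k = \<lceil>log\<^sub>2 n\<rceil>\<close>. Grow a connected set \<open>C\<close> of \<open>n - k\<close> vertices of the tree and let \<open>W\<close> be the
  set of the other \<open>k\<close>. A vertex of \<open>W\<close> has at most one neighbour in \<open>C\<close>, since two of them would
  close a cycle through \<open>C\<close>. So the nonempty sets among the neighbourhoods in \<open>W\<close> of the vertices
  of \<open>C\<close> are pairwise disjoint, and as \<open>n \<le> 2\<^sup>k\<close> there are enough subsets of \<open>W\<close> to enlarge all
  these neighbourhoods to pairwise distinct ones. Add the corresponding edges and make \<open>C\<close> a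
  clique. If now \<open>w \<in> W\<close> is adjacent to \<open>u \<in> C\<close> but not to \<open>v \<in> C\<close>, then \<open>v, u, w\<close> is a
  shortest path, so \<open>W\<close> is a strong resolving set.
\<close>

section \<open>Connected vertex sets of prescribed size\<close>

definition connected_in :: "'a rel \<Rightarrow> 'a set \<Rightarrow> bool" where
  "connected_in E C \<longleftrightarrow> (\<forall>u\<in>C. \<forall>v\<in>C. (u, v) \<in> (E \<inter> C \<times> C)\<^sup>*)"

lemma rtrancl_leaves_set:
  assumes "(u, v) \<in> E\<^sup>*" "u \<in> C" "v \<notin> C"
  obtains x y where "x \<in> C" "y \<notin> C" "(x, y) \<in> E"
  using assms by (metis rtrancl_induct[of u v E "\<lambda>z. z \<in> C"])

lemma connected_in_insert:
  assumes "connected_in E C" "x \<in> C" "(x, y) \<in> E" "sym E"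
  shows "connected_in E (insert y C)"
proof -
  let ?D = "insert y C"
  let ?R = "(E \<inter> ?D \<times> ?D)\<^sup>*"
  have C: "(u, v) \<in> ?R" if "u \<in> C" "v \<in> C" for u v
    using assms(1) that rtrancl_mono[of "E \<inter> C \<times> C" "E \<inter> ?D \<times> ?D"]
    unfolding connected_in_def by blast
  have xy: "(x, y) \<in> ?R" "(y, x) \<in> ?R"
    using assms(2-4) by (auto dest: symD)
  \<comment> \<open>\<open>x\<close> serves as a hub: any two vertices of \<open>?D\<close> are
    joined through it.\<close>
  have "(u, x) \<in> ?R" "(x, u) \<in> ?R" if "u \<in> ?D" for u
    using that xy C assms(2) by auto
  then show ?thesis
    unfolding connected_in_def by (meson rtrancl_trans)
qed

text \<open>\<open>C\<close> grows one vertex at a time: a walk from a vertex of \<open>C\<close> to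
  a vertex outside has an edge leaving \<open>C\<close>, and its far end can be added.\<close>

lemma connected_in_subset_of_card:
  assumes "finite V" "E \<subseteq> V \<times> V" "sym E" "\<And>u v. u \<in> V \<Longrightarrow> v \<in> V \<Longrightarrow> (u, v) \<in> E\<^sup>*"
    and "m \<le> card V"
  shows "\<exists>C\<subseteq>V. card C = m \<and> connected_in E C"
  using assms(5)
proof (induction m)
  case 0
  have "connected_in E {}" by (simp add: connected_in_def)
  then show ?case by (metis card.empty empty_subsetI)
next
  case (Suc m)
  then obtain C where C: "C \<subseteq> V" "card C = m" "connected_in E C" by auto
  then obtain v where v: "v \<in> V" "v \<notin> C"
    using Suc.prems by (metis Suc_n_not_le_n subsetI subset_antisym)
  have fin: "finite C" using C(1) assms(1) by (rule finite_subset)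
  show ?case
  proof (cases "C = {}")
    \<comment> \<open>No edge leaves the empty set, so the first vertex is chosen freely.\<close>
    case True
    have "connected_in E {v}" by (simp add: connected_in_def)
    with True C(2) v show ?thesis by (intro exI[of _ "{v}"]) auto
  next
    case False
    then obtain u where "u \<in> C" by blast
    with v(1) C(1) assms(4) have "(u, v) \<in> E\<^sup>*" by blast
    then obtain x y where xy: "x \<in> C" "y \<notin> C" "(x, y) \<in> E"
      using \<open>u \<in> C\<close> v(2) by (rule rtrancl_leaves_set)
    with C(3) assms(3) have "connected_in E (insert y C)"
      by (blast intro: connected_in_insert)
    moreover have "card (insert y C) = Suc m" "insert y C \<subseteq> V"
      using xy C(1,2) assms(2) fin by auto
    ultimately show ?thesis by blast
  qed
qed

section \<open>Neighbours of an outside vertex in a tree\<close>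

text \<open>Carries the relational connectivity over to walks. The bound on the arcs later keeps a
  vertex outside \<open>C\<close> off the walk.\<close>

lemma (in pair_wf_digraph) rtrancl_restrict_awalk:
  assumes "(u, v) \<in> (parcs G \<inter> C \<times> C)\<^sup>*" "u \<in> pverts G"
  shows "\<exists>p. awalk u p v \<and> set p \<subseteq> C \<times> C"
  using assms(1)
proof (induction rule: rtrancl_induct)
  case base
  then show ?case using assms(2) by (intro exI[of _ "[]"]) (simp add: awalk_Nil_iff)
next
  case (step y z)
  then obtain p where p: "awalk u p y" "set p \<subseteq> C \<times> C" by blast
  have "awalk y [(y, z)] z"
    using step(2) by (auto simp: awalk_simps in_arcsD2)
  with p(1) have "awalk u (p @ [(y, z)]) z" by (rule awalk_appendI)
  with p(2) step(2) show ?case by (intro exI[of _ "p @ [(y, z)]"]) simp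
qed

text \<open>A path inside \<open>C\<close> from \<open>v\<close> to \<open>v'\<close> avoids
  \<open>w\<close>, so closing it through \<open>w\<close> gives a cycle.\<close>

lemma (in pair_graph) acyclic_unique_neighbour:
  assumes acyc: "\<not> (\<exists>p. cycle p \<and> length p \<ge> 3)"
    and C: "C \<subseteq> pverts G" "connected_in (parcs G) C"
    and w: "w \<notin> C" and v: "v \<in> C" "(v, w) \<in> parcs G" and v': "v' \<in> C" "(v', w) \<in> parcs G"
  shows "v = v'"
proof (rule ccontr)
  assume ne: "v \<noteq> v'"
  obtain p where p: "awalk v p v'" "set p \<subseteq> C \<times> C"
    using rtrancl_restrict_awalk C v(1) v'(1) unfolding connected_in_def by blast
  define q where "q = awalk_to_apath p"
  have q: "apath v q v'" "set q \<subseteq> C \<times> C"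
    unfolding q_def using apath_awalk_to_apath[OF p(1)] awalk_to_apath_subset[OF p(1)] p(2) by auto
  then have aw: "awalk v q v'" "distinct (pawalk_verts v q)" by (auto simp: apath_def)
  \<comment> \<open>This rules out the degenerate closed walk \<open>w, v, w\<close>: the cycle
    below gets at least three arcs.\<close>
  have "q \<noteq> []" using q(1) ne by (auto simp: apath_Nil_iff)
  have "set (pawalk_verts v q) \<subseteq> C"
    using set_awalk_verts[OF aw(1)] q(2) v(1) by auto
  with w have w_notin: "w \<notin> set (pawalk_verts v q)" by blast
  have closing: "awalk v' [(v', w)] w"
    using v'(2) by (auto simp: awalk_simps in_arcsD2)
  let ?c = "(w, v) # q @ [(v', w)]"
  have tail_walk: "awalk v (q @ [(v', w)]) w" using aw(1) closing by (rule awalk_appendI)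
  with v(2) have "awalk w ?c w" by (auto simp: awalk_Cons_iff arcs_symmetric)
  moreover have "pawalk_verts v (q @ [(v', w)]) = pawalk_verts v q @ [w]"
    using awalk_verts_append[OF tail_walk] by simp
  then have "distinct (tl (pawalk_verts w ?c))" using aw(2) w_notin by simp
  ultimately have "cycle ?c" unfolding cycle_def by blast
  moreover have "length ?c \<ge> 3" using \<open>q \<noteq> []\<close> by (cases q) auto
  ultimately show False using acyc by blast
qed

section \<open>Distinct enlargements of disjoint sets\<close>

text \<open>Nonempty disjoint sets are already distinct and are kept. Only the empty ones change;
  any subset of \<open>W\<close> not yet taken will do for them.\<close>

lemma distinct_supersets:
  assumes fin: "finite C" "finite W" and card: "card C \<le> 2 ^ card W"
    and sub: "\<And>v. v \<in> C \<Longrightarrow> A v \<subseteq> W"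
    and disj: "\<And>u v. u \<in> C \<Longrightarrow> v \<in> C \<Longrightarrow> A u \<inter> A v \<noteq> {} \<Longrightarrow> u = v"
  obtains f where "inj_on f C" "\<And>v. v \<in> C \<Longrightarrow> A v \<subseteq> f v \<and> f v \<subseteq> W"
proof -
  define D where "D = {v\<in>C. A v \<noteq> {}}"
  have D: "D \<subseteq> C" "finite D" using fin by (auto simp: D_def)
  have inj: "inj_on A D"
    using disj by (auto simp: D_def inj_on_def)
  have AD: "A ` D \<subseteq> Pow W" using sub D(1) by auto
  \<comment> \<open>The kept sets use up exactly \<open>card D\<close> of the subsets of
    \<open>W\<close>, so both sides of \<open>card C \<le> 2 ^ card W\<close> drop by the same
    amount.\<close>
  have "card (C - D) \<le> card (Pow W - A ` D)"
    using card D fin AD inj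
    by (simp add: card_Diff_subset card_image card_Pow)
  then obtain g where g: "g ` (C - D) \<subseteq> Pow W - A ` D" "inj_on g (C - D)"
    using card_le_inj fin by (metis finite_Diff finite_Pow_iff)
  define f where "f v = (if v \<in> D then A v else g v)" for v
  have "inj_on f C"
  proof (rule inj_onI)
    fix u v assume uv: "u \<in> C" "v \<in> C" "f u = f v"
    have "g x \<noteq> A y" if "x \<in> C - D" "y \<in> D" for x y
      using g(1) that by blast
    then show "u = v"
      using uv inj g(2) unfolding f_def
      by (metis Diff_iff inj_onD)
  qed
  moreover have "A v \<subseteq> f v \<and> f v \<subseteq> W" if "v \<in> C" for v
    using that g(1) sub by (auto simp: f_def D_def)
  ultimately show ?thesis by (rule that)
qed

section \<open>Strong resolution by the complement of a clique\<close>

lemma (in pair_graph) shortest_path_exists: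
  assumes "Digraph_Component.connected (with_proj G)" "u \<in> pverts G" "v \<in> pverts G"
  obtains p where "shortest_path G u p v"
proof -
  have "strongly_connected (with_proj G)"
    using symmetric_connected_imp_strongly_connected[OF sym_arcs assms(1)] .
  with assms(2,3) have "u \<rightarrow>\<^sup>*\<^bsub>with_proj G\<^esub> v"
    by (simp add: strongly_connected_def)
  then obtain q where "vpath q (with_proj G) \<and> hd q = u \<and> last q = v"
    using reachable_vpath_conv by blast
  then have "\<exists>p. (vpath p (with_proj G) \<and> hd p = u \<and> last p = v) \<and>
     (\<forall>q. vpath q (with_proj G) \<and> hd q = u \<and> last q = v \<longrightarrow> vwalk_length p \<le> vwalk_length q)"
    by (rule ex_has_least_nat)
  then show ?thesis using that unfolding shortest_path_def by blast
qed

text \<open>A shortest path contains its own end, so a pair that meets a candidate set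
  \<open>W\<close> is resolved by its member in \<open>W\<close>.\<close>

lemma (in pair_graph) strongly_resolves_endpoint:
  assumes "Digraph_Component.connected (with_proj G)" "u \<in> pverts G" "v \<in> pverts G"
  shows "strongly_resolves G v u v" "strongly_resolves G v v u"
proof -
  obtain p where p: "shortest_path G u p v" using shortest_path_exists assms .
  then have "v \<in> set p" by (auto simp: shortest_path_def vpath_def vwalk_def)
  with p show "strongly_resolves G v u v" "strongly_resolves G v v u"
    unfolding strongly_resolves_def by blast+
qed

lemma (in pair_graph) shortest_path_length_2:
  assumes "(v, u) \<in> parcs G" "(u, w) \<in> parcs G" "(v, w) \<notin> parcs G" "v \<noteq> w"
  shows "shortest_path G v [v, u, w] w"
  unfolding shortest_path_def
proof (intro conjI allI impI)
  show "vpath [v, u, w] (with_proj G)"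
    using assms no_loops'
    by (intro vpathI vwalkI) (auto dest: in_arcsD1 in_arcsD2)
  fix q assume q: "vpath q (with_proj G) \<and> hd q = v \<and> last q = w"
  show "vwalk_length [v, u, w] \<le> vwalk_length q"
  proof (rule ccontr)
    assume "\<not> ?thesis"
    then have "length q \<le> 2" by simp
    with q assms(3,4) show False
      \<comment> \<open>The case rule separates lists with no, one, and at least two vertices; a
        walk with two would be the missing arc \<open>(v, w)\<close>.\<close>
      by (cases q rule: vwalk_arcs.cases) (auto simp: vpath_def vwalk_def)
  qed
qed simp_all

lemma (in pair_graph) strong_resolving_set_clique_complement:
  assumes conn: "Digraph_Component.connected (with_proj G)" and W: "W \<subseteq> pverts G"
    and clique: "\<And>u v. u \<in> pverts G - W \<Longrightarrow> v \<in> pverts G - W \<Longrightarrow> u \<noteq> v \<Longrightarrow> (u, v) \<in> parcs G"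
    and nbr: "inj_on (\<lambda>v. {w\<in>W. (v, w) \<in> parcs G}) (pverts G - W)"
  shows "strong_resolving_set G W"
  unfolding strong_resolving_set_def
proof (intro conjI ballI impI W)
  fix u v assume u: "u \<in> pverts G" and v: "v \<in> pverts G" and ne: "u \<noteq> v"
  \<comment> \<open>Both orders are stated because either of the two neighbourhoods may be the one
    containing \<open>w\<close>.\<close>
  have separated: "strongly_resolves G w x y \<and> strongly_resolves G w y x"
    if "w \<in> W" "x \<in> pverts G - W" "y \<in> pverts G - W" "x \<noteq> y"
      "(x, w) \<in> parcs G" "(y, w) \<notin> parcs G" for w x y
  proof -
    have "shortest_path G y [y, x, w] w"
      using that clique[of y x] by (intro shortest_path_length_2) auto
    then show ?thesis
      unfolding strongly_resolves_def by (meson list.set_intros)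
  qed
  show "\<exists>w\<in>W. strongly_resolves G w u v"
  proof (cases "u \<in> W \<or> v \<in> W")
    case True
    then show ?thesis using strongly_resolves_endpoint[OF conn] u v by blast
  next
    case False
    then have "{w\<in>W. (u, w) \<in> parcs G} \<noteq> {w\<in>W. (v, w) \<in> parcs G}"
      using u v ne inj_onD[OF nbr] by blast
    then show ?thesis using separated u v False ne by blast
  qed
qed

section \<open>The supergraph\<close>

text \<open>\<open>f v\<close> is meant to be the whole neighbourhood of \<open>v\<close> outside
  \<open>C\<close>. The converse of \<open>Sigma C f\<close> supplies the opposite arcs.\<close>

definition clique_extension ::
    "'a pair_pre_digraph \<Rightarrow> 'a set \<Rightarrow> ('a \<Rightarrow> 'a set) \<Rightarrow> 'a pair_pre_digraph" where
  "clique_extension G C f =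
     \<lparr> pverts = pverts G,
       parcs = parcs G \<union> {(u, v). u \<in> C \<and> v \<in> C \<and> u \<noteq> v} \<union> Sigma C f \<union> (Sigma C f)\<inverse> \<rparr>"

lemma pair_graph_clique_extension:
  assumes "pair_graph G" "C \<subseteq> pverts G" "\<And>v. v \<in> C \<Longrightarrow> f v \<subseteq> pverts G - C"
  shows "pair_graph (clique_extension G C f)"
proof -
  interpret pair_graph G by fact
  let ?H = "clique_extension G C f"
  have sub: "parcs ?H \<subseteq> pverts G \<times> pverts G"
    using assms(2,3) by (auto simp: clique_extension_def dest: in_arcsD1 in_arcsD2)
  then have "finite (parcs ?H)"
    using pair_finite_verts by (meson finite_SigmaI finite_subset)
  moreover have "pverts ?H = pverts G" by (simp add: clique_extension_def)
  moreover have "symmetric (with_proj ?H)"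
    using arcs_symmetric
    by (auto simp: symmetric_def sym_def clique_extension_def)
  moreover have "fst e \<noteq> snd e" if "e \<in> parcs ?H" for e
    using that assms(3) pair_no_loops by (fastforce simp: clique_extension_def)
  ultimately show ?thesis
    using sub pair_finite_verts by unfold_locales auto
qed

lemma spanning_clique_extension:
  assumes "pair_graph G" "C \<subseteq> pverts G" "\<And>v. v \<in> C \<Longrightarrow> f v \<subseteq> pverts G - C"
  shows "spanning (with_proj G) (with_proj (clique_extension G C f))"
proof -
  interpret G: pair_graph G by fact
  interpret H: pair_graph "clique_extension G C f"
    using assms by (rule pair_graph_clique_extension)
  show ?thesis
    using G.wf_digraph H.wf_digraph
    by (auto simp: spanning_def subgraph_def compatible_def clique_extension_def)
qed

lemma strong_resolving_set_clique_extension: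
  assumes "pair_graph G" "Digraph_Component.connected (with_proj G)" "C \<subseteq> pverts G"
    and f: "inj_on f C"
      "\<And>v. v \<in> C \<Longrightarrow> {w\<in>pverts G - C. (v, w) \<in> parcs G} \<subseteq> f v \<and> f v \<subseteq> pverts G - C"
  shows "strong_resolving_set (clique_extension G C f) (pverts G - C)"
proof -
  let ?H = "clique_extension G C f"
  interpret pair_graph ?H
    using assms by (intro pair_graph_clique_extension) auto
  have conn: "Digraph_Component.connected (with_proj ?H)"
    using assms by (intro connected_if_spanning[OF assms(2)] spanning_clique_extension) auto
  have verts: "pverts ?H = pverts G" by (simp add: clique_extension_def)
  have C: "pverts G - (pverts G - C) = C" using assms(3) by blast
  \<comment> \<open>Old neighbours of \<open>v\<close> outside \<open>C\<close> already lie in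
    \<open>f v\<close>, so the neighbourhood is exactly \<open>f v\<close> and inherits injectivity
    from \<open>f\<close>.\<close>
  have nbr: "{w\<in>pverts G - C. (v, w) \<in> parcs ?H} = f v" if "v \<in> C" for v
    using f(2)[OF that] that by (auto simp: clique_extension_def)
  have "inj_on (\<lambda>v. {w\<in>pverts G - C. (v, w) \<in> parcs ?H}) C"
    using f(1) by (subst inj_on_cong[OF nbr])
  moreover have "(u, v) \<in> parcs ?H" if "u \<in> C" "v \<in> C" "u \<noteq> v" for u v
    using that by (simp add: clique_extension_def)
  ultimately show ?thesis
    by (intro strong_resolving_set_clique_complement conn) (unfold verts C, auto)
qed

section \<open>The bound for trees\<close>

lemma threshold_strong_dim_le:
  assumes "pair_graph H" "spanning (with_proj G) (with_proj H)" "strong_resolving_set H W"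
  shows "threshold_strong_dim G \<le> card W"
proof -
  have "threshold_strong_dim G \<le> strong_dim H"
    unfolding threshold_strong_dim_def using assms(1,2) by (intro Least_le) blast
  also have "\<dots> \<le> card W"
    unfolding strong_dim_def using assms(3) by (intro Least_le) blast
  finally show ?thesis .
qed

text \<open>\<open>k \<le> card (pverts T)\<close> leaves room for a set \<open>W\<close> of size
  \<open>k\<close>; the other bound provides enough subsets of \<open>W\<close>.\<close>

lemma threshold_strong_dim_tree_le:
  assumes tree: "undirected_tree T" and k: "k \<le> card (pverts T)" "card (pverts T) \<le> 2 ^ k"
  shows "threshold_strong_dim T \<le> k"
proof -
  have "pair_graph T" and conn: "Digraph_Component.connected (with_proj T)"
    and acyc: "\<not> (\<exists>p. pre_digraph.cycle (with_proj T) p \<and> length p \<ge> 3)"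
    using tree by (auto simp: undirected_tree_def)
  interpret pair_graph T by fact
  have "strongly_connected (with_proj T)"
    using symmetric_connected_imp_strongly_connected[OF sym_arcs conn] .
  then have "(u, v) \<in> (parcs T)\<^sup>*" if "u \<in> pverts T" "v \<in> pverts T" for u v
    using that by (auto simp: strongly_connected_def reachable_conv)
  moreover have "parcs T \<subseteq> pverts T \<times> pverts T"
    by (auto dest: in_arcsD1 in_arcsD2)
  ultimately obtain C where C: "C \<subseteq> pverts T" "card C = card (pverts T) - k" "connected_in (parcs T) C"
    using connected_in_subset_of_card[of "pverts T" "parcs T" "card (pverts T) - k"]
      pair_finite_verts sym_arcs
    by (auto simp: symmetric_def)
  define W where "W = pverts T - C"
  define A where "A v = {w\<in>W. (v, w) \<in> parcs T}" for v
  have fin: "finite C" "finite W"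
    using C(1) pair_finite_verts by (auto simp: W_def intro: finite_subset)
  have card_W: "card W = k"
    using C k(1) fin by (simp add: W_def card_Diff_subset)
  have "card C \<le> 2 ^ card W" using C(2) k(2) card_W by simp
  moreover have "A v \<subseteq> W" for v by (auto simp: A_def)
  \<comment> \<open>A common element of \<open>A u\<close> and \<open>A v\<close> is a vertex
    outside \<open>C\<close> adjacent to both \<open>u\<close> and \<open>v\<close>.\<close>
  moreover have "u = v" if "u \<in> C" "v \<in> C" "A u \<inter> A v \<noteq> {}" for u v
    using that acyclic_unique_neighbour[OF acyc C(1,3)] by (auto simp: A_def W_def)
  ultimately obtain f where f: "inj_on f C" "\<And>v. v \<in> C \<Longrightarrow> A v \<subseteq> f v \<and> f v \<subseteq> W"
    using fin by (metis distinct_supersets)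
  let ?H = "clique_extension T C f"
  have "pair_graph ?H" "spanning (with_proj T) (with_proj ?H)"
    using \<open>pair_graph T\<close> C(1) f(2)
    by (auto simp: W_def intro!: pair_graph_clique_extension spanning_clique_extension)
  moreover have "strong_resolving_set ?H W"
    unfolding W_def using \<open>pair_graph T\<close> conn C(1) f
    by (intro strong_resolving_set_clique_extension) (auto simp: A_def W_def)
  ultimately show ?thesis using threshold_strong_dim_le card_W by metis
qed

theorem theorem5p2:
  fixes T :: "'a pair_pre_digraph" and n :: nat
  assumes "undirected_tree T"
    and "card (pverts T) = n"
    and "n \<ge> 2"
  shows "int (threshold_strong_dim T) \<le> \<lceil>log 2 (real n)\<rceil>"
proof -
  define k where "k = nat \<lceil>log 2 (real n)\<rceil>"
  \<comment> \<open>Nonnegativity ensures that \<open>nat\<close> does not truncate the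
    ceiling.\<close>
  have "0 \<le> log 2 (real n)" using assms(3) by simp
  then have k: "int k = \<lceil>log 2 (real n)\<rceil>" unfolding k_def by linarith
  \<comment> \<open>This crude estimate yields \<open>k \<le> n\<close>.\<close>
  have "real n \<le> 2 ^ n" using of_nat_less_two_power[of n] by (rule less_imp_le)
  then have "log 2 (real n) \<le> real n"
    using assms(3) by (simp add: log_le_iff powr_realpow)
  then have "k \<le> n" by (simp add: k_def ceiling_le_iff)
  moreover have "log 2 (real n) \<le> real k"
    using k by linarith
  then have "real n \<le> 2 ^ k"
    using assms(3) by (simp add: log_le_iff powr_realpow)
  then have "n \<le> 2 ^ k" by (metis of_nat_le_iff of_nat_numeral of_nat_power)
  ultimately have "threshold_strong_dim T \<le> k"
    using threshold_strong_dim_tree_le assms(1,2) by blast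
  with k show ?thesis by linarith
qed

end
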